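(* Every $P_5$-free Hamiltonian chordal graph is fully cycle extendable.
   Context: All graphs are finite, simple and undirected. $P_5$ is the path on $5$ vertices; a graph is $P_5$-free if it has no induced subgraph isomorphic to $P_5$. A graph is chordal if it has no induced cycle of length $4$ or more. A graph is Hamiltonian if it has a cycle through all its vertices. If $C$ is a cycle of length $m$ in $G$, an extension of $C$ is a cycle $C'$ of length $m+1$ with $V(C')\setminus V(C)=\{v\}$ for a single vertex $v$; $C$ is extendable if it has an extension. $G$ is cycle extendable if every non-Hamiltonian cycle of $G$ is extendable, and fully cycle extendable if in addition every vertex of $G$ lies on a triangle. *)

theory Defs
  imports Graph_Theory.Graph_Theory
begin

(* A finite simple undirected graph is an instance of the locale graph of Graph_Theory: a finite
   symmetric digraph without loops and without parallel arcs, each undirected edge being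
   represented by its two orientations. *)

definition path_graph :: "nat \<Rightarrow> nat pair_pre_digraph" where
  "path_graph n =
     \<lparr> pverts = {0..<n},
       parcs = {(i, j). i < n \<and> j < n \<and> (j = Suc i \<or> i = Suc j)} \<rparr>"

(* The cycle on n vertices, meaningful for n \<ge> 3 (for n = 1 it has a loop). *)
definition cycle_graph :: "nat \<Rightarrow> nat pair_pre_digraph" where
  "cycle_graph n =
     \<lparr> pverts = {0..<n},
       parcs = {(i, j). i < n \<and> j < n \<and> (j = Suc i mod n \<or> i = Suc j mod n)} \<rparr>"

definition has_induced :: "('c, 'd) pre_digraph \<Rightarrow> ('a, 'b) pre_digraph \<Rightarrow> bool" where
  "has_induced F G \<longleftrightarrow> (\<exists>H. induced_subgraph H G \<and> digraph_iso H F)"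

definition P5_free :: "('a, 'b) pre_digraph \<Rightarrow> bool" where
  "P5_free G \<longleftrightarrow> \<not> has_induced (with_proj (path_graph 5)) G"

definition chordal :: "('a, 'b) pre_digraph \<Rightarrow> bool" where
  "chordal G \<longleftrightarrow> (\<forall>n\<ge>4. \<not> has_induced (with_proj (cycle_graph n)) G)"

(* The library's cycle also accepts the closed walk u, v, u along the two orientations of one
   edge, which is not a cycle of the undirected graph; hence the lower bound on the length.
   A cycle is a list of arcs, i.e. it comes with a starting vertex and a direction. *)
definition graph_cycle :: "('a, 'b) pre_digraph \<Rightarrow> 'b awalk \<Rightarrow> bool" where
  "graph_cycle G C \<longleftrightarrow> pre_digraph.cycle G C \<and> 3 \<le> length C"

(* Every vertex of a closed walk is the tail of one of its arcs. *)
definition cycle_verts :: "('a, 'b) pre_digraph \<Rightarrow> 'b awalk \<Rightarrow> 'a set" where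
  "cycle_verts G C = tail G ` set C"

definition hamiltonian_cycle :: "('a, 'b) pre_digraph \<Rightarrow> 'b awalk \<Rightarrow> bool" where
  "hamiltonian_cycle G C \<longleftrightarrow> graph_cycle G C \<and> cycle_verts G C = verts G"

definition hamiltonian :: "('a, 'b) pre_digraph \<Rightarrow> bool" where
  "hamiltonian G \<longleftrightarrow> (\<exists>C. hamiltonian_cycle G C)"

definition cycle_extension :: "('a, 'b) pre_digraph \<Rightarrow> 'b awalk \<Rightarrow> 'b awalk \<Rightarrow> bool" where
  "cycle_extension G C C' \<longleftrightarrow>
     graph_cycle G C' \<and> length C' = length C + 1 \<and>
     (\<exists>v. cycle_verts G C' - cycle_verts G C = {v})"

definition extendable :: "('a, 'b) pre_digraph \<Rightarrow> 'b awalk \<Rightarrow> bool" where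
  "extendable G C \<longleftrightarrow> (\<exists>C'. cycle_extension G C C')"

definition cycle_extendable :: "('a, 'b) pre_digraph \<Rightarrow> bool" where
  "cycle_extendable G \<longleftrightarrow>
     (\<forall>C. graph_cycle G C \<and> \<not> hamiltonian_cycle G C \<longrightarrow> extendable G C)"

definition fully_cycle_extendable :: "('a, 'b) pre_digraph \<Rightarrow> bool" where
  "fully_cycle_extendable G \<longleftrightarrow>
     cycle_extendable G \<and>
     (\<forall>v\<in>verts G. \<exists>T. graph_cycle G T \<and> length T = 3 \<and> v \<in> cycle_verts G T)"

end

theory Submission
  imports Defs
begin

text \<open>
  In a \<open>P\<^sub>5\<close>-free chordal graph every vertex \<open>v\<close> is simplicial or adjacent to a simplicial vertex.
  Indeed, let \<open>K\<close> be the set of neighbours of \<open>v\<close> that have a neighbour outside \<open>N[v]\<close>. Two elements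
  of \<open>K\<close> attached to the same component of \<open>G - N[v]\<close> are adjacent by chordality, and two elements
  attached to different components are adjacent by \<open>P\<^sub>5\<close>-freeness, so \<open>K\<close> is a clique. By Dirac's
  argument the chordal graph \<open>G[N[v]]\<close> has a simplicial vertex outside \<open>K\<close>, and this vertex is
  simplicial in \<open>G\<close>.

  Now let \<open>C\<close> be a non-Hamiltonian cycle, \<open>v\<close> a vertex outside \<open>C\<close>, and \<open>s\<close> a simplicial vertex equal
  or adjacent to \<open>v\<close>. If \<open>s\<close> lies on \<open>C\<close>, then \<open>v\<close> is adjacent to \<open>s\<close> and to both neighbours of \<open>s\<close>
  on \<open>C\<close>, so it can be inserted next to \<open>s\<close>. Otherwise \<open>G - s\<close> is still Hamiltonian, because the
  Hamiltonian cycle can bypass \<open>s\<close>, and induction applies; in the extreme case that \<open>C\<close> covers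
  \<open>G - s\<close>, the Hamiltonian cycle of \<open>G\<close> itself extends \<open>C\<close>.
\<close>

section \<open>Graphs as symmetric irreflexive relations\<close>

locale simple_graph =
  fixes E :: "'a \<Rightarrow> 'a \<Rightarrow> bool"
  assumes sym: "E x y \<Longrightarrow> E y x"
    and irrefl: "\<not> E x x"
begin

definition clique :: "'a set \<Rightarrow> bool" where
  "clique K \<longleftrightarrow> (\<forall>a\<in>K. \<forall>b\<in>K. a \<noteq> b \<longrightarrow> E a b)"

definition simplicial :: "'a set \<Rightarrow> 'a \<Rightarrow> bool" where
  "simplicial U s \<longleftrightarrow> s \<in> U \<and> clique {a\<in>U. E s a}"

text \<open>The equivalence of adjacencies makes the copy of \<open>F\<close> induced. With a vertex
  set \<open>U\<close> as target, passing to an induced subgraph is just passing to a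
  subset.\<close>

definition embeds :: "'c pair_pre_digraph \<Rightarrow> ('c \<Rightarrow> 'a) \<Rightarrow> 'a set \<Rightarrow> bool" where
  "embeds F f U \<longleftrightarrow> inj_on f (pverts F) \<and> f ` pverts F \<subseteq> U \<and>
     (\<forall>i\<in>pverts F. \<forall>j\<in>pverts F. (i, j) \<in> parcs F \<longleftrightarrow> E (f i) (f j))"

definition chordal_on :: "'a set \<Rightarrow> bool" where
  "chordal_on U \<longleftrightarrow> (\<forall>n\<ge>4. \<nexists>f. embeds (cycle_graph n) f U)"

definition P5_free_on :: "'a set \<Rightarrow> bool" where
  "P5_free_on U \<longleftrightarrow> (\<nexists>f. embeds (path_graph 5) f U)"

text \<open>Only inner vertices must lie in \<open>B\<close>, so that the ends may be attached to
  \<open>B\<close> from outside. Values of \<open>p\<close> beyond \<open>k\<close> are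
  arbitrary.\<close>

definition walk_in :: "'a set \<Rightarrow> 'a \<Rightarrow> 'a \<Rightarrow> nat \<Rightarrow> (nat \<Rightarrow> 'a) \<Rightarrow> bool" where
  "walk_in B a b k p \<longleftrightarrow> p 0 = a \<and> p k = b \<and> (\<forall>i<k. E (p i) (p (Suc i))) \<and>
     (\<forall>i. 0 < i \<and> i < k \<longrightarrow> p i \<in> B)"

text \<open>Only the vertices entered are tested for \<open>B\<close>, not the starting one; hence
  the separate assumption \<open>x \<in> B\<close> in lemmas below.\<close>

definition reach_in :: "'a set \<Rightarrow> 'a \<Rightarrow> 'a \<Rightarrow> bool" where
  "reach_in B = (\<lambda>x y. E x y \<and> y \<in> B)\<^sup>*\<^sup>*"

definition cyc :: "'a list \<Rightarrow> bool" where
  "cyc xs \<longleftrightarrow> distinct xs \<and> 3 \<le> length xs \<and> successively E xs \<and> E (last xs) (hd xs)"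

lemma embeds_mono: "embeds F f U \<Longrightarrow> U \<subseteq> W \<Longrightarrow> embeds F f W"
  unfolding embeds_def by blast

lemma chordal_on_subset: "chordal_on W \<Longrightarrow> U \<subseteq> W \<Longrightarrow> chordal_on U"
  unfolding chordal_on_def using embeds_mono by blast

lemma P5_free_on_subset: "P5_free_on W \<Longrightarrow> U \<subseteq> W \<Longrightarrow> P5_free_on U"
  unfolding P5_free_on_def using embeds_mono by blast

lemma cliqueD: "clique K \<Longrightarrow> a \<in> K \<Longrightarrow> b \<in> K \<Longrightarrow> a \<noteq> b \<Longrightarrow> E a b"
  unfolding clique_def by blast

lemma simplicialD:
  "simplicial U s \<Longrightarrow> a \<in> U \<Longrightarrow> b \<in> U \<Longrightarrow> E s a \<Longrightarrow> E s b \<Longrightarrow> a \<noteq> b \<Longrightarrow> E a b"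
  unfolding simplicial_def clique_def by blast

lemma reach_in_closed: "reach_in B x y \<Longrightarrow> x \<in> B \<Longrightarrow> y \<in> B"
  unfolding reach_in_def by (induction rule: rtranclp_induct) auto

section \<open>Shortest walks and induced cycles\<close>

text \<open>Jumping from \<open>p i\<close> straight to \<open>p j\<close> skips the
  \<open>j - Suc i\<close> vertices strictly between them.\<close>

lemma walk_in_shortcut:
  assumes p: "walk_in B a b k p" and "i < j" "j \<le> k" "E (p i) (p j)"
  shows "\<exists>q. walk_in B a b (k - (j - Suc i)) q"
proof -
  define q where "q t = (if t \<le> i then p t else p (t + (j - Suc i)))" for t
  have "E (q t) (q (Suc t))" if "t < k - (j - Suc i)" for t
  proof -
    consider "t < i" | "t = i" | "t > i" by linarith
    then show ?thesis
      using p assms(2-4) that by cases (auto simp: q_def walk_in_def)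
  qed
  moreover have "q 0 = a" "q (k - (j - Suc i)) = b"
    using p assms(2,3) by (auto simp: q_def walk_in_def)
  moreover have "q t \<in> B" if "0 < t" "t < k - (j - Suc i)" for t
    using p assms(2,3) that by (auto simp: q_def walk_in_def)
  ultimately show ?thesis unfolding walk_in_def by blast
qed

text \<open>The closed piece between the two visits to the same vertex is dropped.\<close>

lemma walk_in_cut_loop:
  assumes p: "walk_in B a b k p" and "i < j" "j \<le> k" "p i = p j"
  shows "\<exists>q. walk_in B a b (k - (j - i)) q"
proof -
  define q where "q t = (if t \<le> i then p t else p (t + (j - i)))" for t
  have "E (q t) (q (Suc t))" if "t < k - (j - i)" for t
  proof -
    consider "t < i" | "t = i" | "t > i" by linarith
    then show ?thesis
    proof cases
      case 2
      then have "E (p j) (p (Suc j))" using p that assms(2,3) by (auto simp: walk_in_def)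
      then show ?thesis using 2 assms(2,4) by (simp add: q_def)
    qed (use p assms(2-4) that in \<open>auto simp: q_def walk_in_def\<close>)
  qed
  moreover have "q 0 = a"
    using p by (auto simp: q_def walk_in_def)
  moreover have "q (k - (j - i)) = b"
  proof (cases "j = k")
    \<comment> \<open>Here the new length is \<open>i\<close>, and the walk ends in
      \<open>p i = p k = b\<close>.\<close>
    case True
    then show ?thesis using p assms(2,4) by (auto simp: q_def walk_in_def)
  next
    case False
    then show ?thesis using p assms(2,3) by (auto simp: q_def walk_in_def)
  qed
  moreover have "q t \<in> B" if "0 < t" "t < k - (j - i)" for t
    using p assms(2,3) that by (auto simp: q_def walk_in_def)
  ultimately show ?thesis unfolding walk_in_def by blast
qed

text \<open>A walk of least length works: a repeated vertex or a chord would yield a shorter walk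
  with the same ends, by the two surgeries above.\<close>

lemma induced_walk_exists:
  assumes "walk_in B a b k0 p0"
  shows "\<exists>k p. walk_in B a b k p \<and> inj_on p {..k} \<and>
    (\<forall>i j. Suc i < j \<and> j \<le> k \<longrightarrow> \<not> E (p i) (p j))"
proof -
  define k where "k = (LEAST k. \<exists>p. walk_in B a b k p)"
  have "\<exists>p. walk_in B a b k p" unfolding k_def by (rule LeastI_ex) (use assms in blast)
  then obtain p where p: "walk_in B a b k p" by blast
  have least: "\<not> walk_in B a b m q" if "m < k" for m q
    using that not_less_Least unfolding k_def by blast
  have neq: "p i \<noteq> p j" if ij: "i < j" "j \<le> k" for i j
  proof
    assume "p i = p j"
    then obtain q where "walk_in B a b (k - (j - i)) q"
      using walk_in_cut_loop[OF p ij] by blast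
    then show False using least[of "k - (j - i)"] ij by auto
  qed
  have "inj_on p {..k}"
    by (rule linorder_inj_onI) (use neq in auto)
  moreover have "\<not> E (p i) (p j)" if ij: "Suc i < j" "j \<le> k" for i j
  proof
    assume "E (p i) (p j)"
    then obtain q where "walk_in B a b (k - (j - Suc i)) q"
      using walk_in_shortcut[OF p Suc_lessD[OF ij(1)] ij(2)] by blast
    then show False using least[of "k - (j - Suc i)"] ij by auto
  qed
  ultimately show ?thesis using p by blast
qed

lemma reach_in_walk:
  assumes "reach_in B x y" "x \<in> B"
  shows "\<exists>k p. walk_in B x y k p"
  using assms(1) unfolding reach_in_def
proof (induction rule: rtranclp_induct)
  case base
  have "walk_in B x x 0 (\<lambda>_. x)" by (simp add: walk_in_def)
  then show ?case by blast
next
  case (step y z)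
  then obtain k p where p: "walk_in B x y k p" by blast
  have "y \<in> B"
    using step.hyps(1) reach_in_closed[OF _ assms(2)] unfolding reach_in_def by blast
  then have "walk_in B x z (Suc k) (p(Suc k := z))"
    using p step.hyps(2) by (auto simp: walk_in_def less_Suc_eq)
  then show ?case by blast
qed

text \<open>The walk is shifted by one position, with \<open>a\<close> put in front at 0 and
  \<open>b\<close> behind at \<open>k + 2\<close>.\<close>

lemma walk_in_extend:
  assumes "walk_in B x y k p" "E a x" "E y b" "x \<in> B" "y \<in> B"
  shows "walk_in B a b (k + 2) (\<lambda>i. case i of 0 \<Rightarrow> a | Suc j \<Rightarrow> if j \<le> k then p j else b)"
proof -
  have "E (p j) b" if "j \<le> k" "\<not> Suc j \<le> k" for j
    using that assms(1,3) by (auto simp: walk_in_def not_less_eq_eq dest: antisym)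
  moreover have "p j \<in> B" if "j \<le> k" for j
  proof -
    consider "j = 0" | "j = k" | "0 < j" "j < k" using \<open>j \<le> k\<close> by linarith
    then show ?thesis by cases (use assms in \<open>auto simp: walk_in_def\<close>)
  qed
  ultimately show ?thesis
    using assms(1,2) by (auto simp: walk_in_def less_Suc_eq_le Suc_le_eq split: nat.splits)
qed

text \<open>A shortest \<open>a\<close>-\<open>b\<close> path through \<open>B\<close> would close up through \<open>x\<close> to an induced cycle.\<close>
lemma attachments_adjacent:
  assumes ch: "chordal_on U" and U: "x \<in> U" "a \<in> U" "b \<in> U" "B \<subseteq> U"
    and B: "\<And>y. y \<in> B \<Longrightarrow> y \<noteq> x \<and> \<not> E x y"
    and xa: "E x a" "E x b" and ab: "a \<noteq> b"
    and a': "E a a'" "a' \<in> B" and b': "E b b'" and r: "reach_in B a' b'"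
  shows "E a b"
proof (rule ccontr)
  assume nab: "\<not> E a b"
  have b'B: "b' \<in> B" using reach_in_closed[OF r a'(2)] .
  obtain k0 p0 where "walk_in B a' b' k0 p0" using reach_in_walk[OF r a'(2)] by blast
  from induced_walk_exists[OF walk_in_extend[OF this a'(1) sym[OF b'] a'(2) b'B]]
  obtain k p where p: "walk_in B a b k p" and inj: "inj_on p {..k}"
    and ind: "\<And>i j. Suc i < j \<Longrightarrow> j \<le> k \<Longrightarrow> \<not> E (p i) (p j)"
    by blast
  have p0: "p 0 = a" and pk: "p k = b" and step: "\<And>i. i < k \<Longrightarrow> E (p i) (p (Suc i))"
    and int: "\<And>i. 0 < i \<Longrightarrow> i < k \<Longrightarrow> p i \<in> B"
    using p by (auto simp: walk_in_def)
  have "k \<noteq> 0" using p0 pk ab by (cases k) auto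
  moreover have "k \<noteq> 1"
  proof
    assume "k = 1"
    then show False using p0 pk nab step[of 0] by simp
  qed
  ultimately have k: "k \<ge> 2" by linarith
  have x: "p i \<noteq> x" "E x (p i) \<longleftrightarrow> i = 0 \<or> i = k" if "i \<le> k" for i
  proof -
    consider "i = 0" | "i = k" | "0 < i" "i < k" using \<open>i \<le> k\<close> by linarith
    then have "p i \<noteq> x \<and> (E x (p i) \<longleftrightarrow> i = 0 \<or> i = k)"
      by cases (use p0 pk xa irrefl B int in auto)
    then show "p i \<noteq> x" "E x (p i) \<longleftrightarrow> i = 0 \<or> i = k" by auto
  qed
  have adj: "E (p i) (p j) \<longleftrightarrow> j = Suc i \<or> i = Suc j" if "i \<le> k" "j \<le> k" for i j
  proof -
    consider "i = j" | "j = Suc i" | "i = Suc j" | "Suc i < j" | "Suc j < i" by linarith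
    then show ?thesis
    proof cases
      case 1
      then show ?thesis using irrefl by simp
    next
      case 2
      then show ?thesis using step[of i] that by simp
    next
      case 3
      then show ?thesis using sym[OF step[of j]] that by simp
    next
      case 4
      then show ?thesis using ind that by simp
    next
      case 5
      then have "\<not> E (p j) (p i)" using ind that by blast
      then have "\<not> E (p i) (p j)" using sym by blast
      then show ?thesis using 5 by simp
    qed
  qed
  \<comment> \<open>The path takes positions 0 to \<open>k\<close> and \<open>x\<close> takes
    position \<open>Suc k\<close>. Since \<open>x\<close> sees only the two ends of the path, this
    is an induced cycle of length \<open>k + 2\<close>, at least 4.\<close>
  define f where "f i = (if i \<le> k then p i else x)" for i
  let ?n = "k + 2"
  have mem: "f i \<in> U" for i
  proof (cases "i \<le> k")
    case True
    consider "i = 0" | "i = k" | "0 < i" "i < k" using True by linarith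
    then show ?thesis by cases (use U p0 pk int True in \<open>auto simp: f_def\<close>)
  qed (use U in \<open>simp add: f_def\<close>)
  have injf: "inj_on f {0..<?n}"
  proof (rule linorder_inj_onI)
    fix i j assume "i < j" "i \<in> {0..<?n}" "j \<in> {0..<?n}"
    then show "f i \<noteq> f j"
      using inj x(1) by (auto simp: f_def inj_on_def)
  qed auto
  have "(j = Suc i mod ?n \<or> i = Suc j mod ?n) \<longleftrightarrow> E (f i) (f j)"
    if ij: "i < ?n" "j < ?n" for i j
  proof -
    have m: "Suc t mod ?n = (if t = Suc k then 0 else Suc t)" if "t < ?n" for t
      using that by (auto simp: mod_Suc)
    have sx: "E (p t) x \<longleftrightarrow> E x (p t)" for t using sym by blast
    consider "i \<le> k" "j \<le> k" | "i = Suc k" "j \<le> k" | "i \<le> k" "j = Suc k" | "i = Suc k" "j = Suc k"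
      using ij by linarith
    then show ?thesis
      by cases (use k ij in \<open>auto simp: m f_def adj x irrefl sx\<close>)
  qed
  then have "embeds (cycle_graph ?n) f U"
    using mem injf by (auto simp: embeds_def cycle_graph_def)
  then show False using ch k unfolding chordal_on_def by force
qed

section \<open>Simplicial vertices of chordal graphs\<close>

text \<open>Dirac's argument, with a clique to be avoided so that the induction goes through. A
  component \<open>B\<close> of the non-neighbours of some \<open>x\<close> is attached to the
  neighbours of \<open>x\<close> by a clique \<open>S\<close>; induction on
  \<open>B \<union> S\<close>, avoiding \<open>S\<close>, yields a vertex of
  \<open>B\<close>.\<close>

lemma simplicial_outside_clique:
  assumes "finite U" "chordal_on U" "K \<subset> U" "clique K"
  shows "\<exists>s\<in>U - K. simplicial U s"
  using assms
proof (induction "card U" arbitrary: U K rule: less_induct)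
  case less
  show ?case
  proof (cases "clique U")
    case True
    then have "simplicial U s" if "s \<in> U" for s
      using that by (auto simp: simplicial_def clique_def)
    then show ?thesis using less.prems(3) by blast
  next
    case False
    then obtain x0 y0 where xy0: "x0 \<in> U" "y0 \<in> U" "x0 \<noteq> y0" "\<not> E x0 y0"
      unfolding clique_def by blast
    \<comment> \<open>All non-neighbours of \<open>x\<close> must avoid \<open>K\<close>. If a
      vertex of \<open>K\<close> has a non-neighbour, it serves as \<open>x\<close>, because
      \<open>K\<close> is a clique. Otherwise every vertex of \<open>K\<close> is adjacent to all
      others, and any non-adjacent pair will do.\<close>
    obtain x y where xy: "x \<in> U" "y \<in> U" "x \<noteq> y" "\<not> E x y"
      and K: "\<And>z. z \<in> U \<Longrightarrow> z \<noteq> x \<Longrightarrow> \<not> E x z \<Longrightarrow> z \<notin> K"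
    proof (cases "\<exists>x\<in>K. \<exists>y\<in>U. x \<noteq> y \<and> \<not> E x y")
      case True
      then obtain x y where "x \<in> K" "y \<in> U" "x \<noteq> y" "\<not> E x y" by blast
      then show ?thesis using that[of x y] less.prems(3,4) cliqueD by blast
    next
      case False
      then show ?thesis using that[of x0 y0] xy0 sym by blast
    qed
    define R where "R = {z\<in>U. z \<noteq> x \<and> \<not> E x z}"
    define B where "B = {z. reach_in R y z}"
    define S where "S = {a\<in>U. E x a \<and> (\<exists>z\<in>B. E a z)}"
    have yR: "y \<in> R" using xy by (auto simp: R_def)
    have BR: "B \<subseteq> R" using reach_in_closed yR unfolding B_def by blast
    have yB: "y \<in> B" by (simp add: B_def reach_in_def)
    \<comment> \<open>By symmetry \<open>B\<close> is the whole component of \<open>y\<close> in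
      \<open>R\<close>, so any two of its vertices reach each other.\<close>
    have reachB: "reach_in R u w" if "u \<in> B" "w \<in> B" for u w
    proof -
      have "reach_in R z y" if "reach_in R y z" for z
        using that unfolding reach_in_def
      proof (induction rule: rtranclp_induct)
        case (step z1 z2)
        then have "z1 \<in> R" using reach_in_closed[OF _ yR] unfolding reach_in_def by blast
        then have "E z2 z1 \<and> z1 \<in> R" using step.hyps(2) sym by blast
        then show ?case using step.IH by (rule converse_rtranclp_into_rtranclp)
      qed simp
      then show ?thesis using \<open>u \<in> B\<close> \<open>w \<in> B\<close> unfolding B_def reach_in_def by force
    qed
    have "clique S"
      unfolding clique_def
    proof (intro ballI impI)
      fix a b assume "a \<in> S" "b \<in> S" "a \<noteq> b"
      then obtain a' b' where a': "E a a'" "a' \<in> B" and b': "E b b'" "b' \<in> B"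
        and ab: "a \<in> U" "b \<in> U" "E x a" "E x b" by (auto simp: S_def)
      show "E a b"
      proof (rule attachments_adjacent[OF less.prems(2) xy(1) ab(1,2) _ _ ab(3,4) \<open>a \<noteq> b\<close> a'(1) _ b'(1)])
        show "a' \<in> R" using a'(2) BR by blast
        show "reach_in R a' b'" using reachB a'(2) b'(2) by blast
      qed (auto simp: R_def)
    qed
    \<comment> \<open>The set shrinks because \<open>x\<close> lies neither in \<open>B\<close> nor
      in \<open>S\<close>.\<close>
    moreover have sub: "B \<union> S \<subset> U" using BR xy(1) irrefl by (auto simp: R_def S_def)
    moreover have "S \<subset> B \<union> S" using yB xy by (auto simp: S_def)
    ultimately obtain s where s: "s \<in> B" "simplicial (B \<union> S) s"
      using less.hyps[OF psubset_card_mono[OF less.prems(1) sub]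
          finite_subset[OF psubset_imp_subset[OF sub] less.prems(1)]
          chordal_on_subset[OF less.prems(2) psubset_imp_subset[OF sub]], of S] by blast
    \<comment> \<open>Neighbours of \<open>s\<close> that are adjacent to \<open>x\<close> belong to
      \<open>S\<close>; the others lie in \<open>R\<close> and hence in the component
      \<open>B\<close>.\<close>
    have "z \<in> B \<union> S" if "z \<in> U" "E s z" for z
    proof (cases "E x z")
      case True
      then show ?thesis using that(1) s(1) sym[OF that(2)] by (auto simp: S_def)
    next
      case False
      moreover have "z \<noteq> x" using s(1) BR that(2) sym[of s z] by (auto simp: R_def)
      ultimately have "z \<in> R" using that by (simp add: R_def)
      then show ?thesis using s(1) that(2)
        by (auto simp: B_def reach_in_def intro: rtranclp.rtrancl_into_rtrancl)
    qed
    then have "{a\<in>U. E s a} \<subseteq> {a\<in>B \<union> S. E s a}" by blast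
    then have "simplicial U s"
      using s sub unfolding simplicial_def clique_def by blast
    moreover have "s \<notin> K" "s \<in> U" using s(1) BR K by (auto simp: R_def)
    ultimately show ?thesis by blast
  qed
qed

lemma simplicial_dominating:
  assumes fin: "finite U" and ch: "chordal_on U" and P5: "P5_free_on U" and v: "v \<in> U"
  shows "\<exists>s. simplicial U s \<and> (s = v \<or> E v s)"
proof -
  define N where "N = {a\<in>U. a = v \<or> E v a}"
  define R where "R = U - N"
  define K where "K = {a\<in>U. E v a \<and> (\<exists>z\<in>R. E a z)}"
  have RD: "z \<in> U" "z \<noteq> v" "\<not> E v z" if "z \<in> R" for z
    using that by (auto simp: R_def N_def)
  have "clique K"
    unfolding clique_def
  proof (intro ballI impI)
    fix a b assume "a \<in> K" "b \<in> K" "a \<noteq> b"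
    then obtain a' b' where a': "a' \<in> R" "E a a'" and b': "b' \<in> R" "E b b'"
      and ab: "a \<in> U" "b \<in> U" "E v a" "E v b" by (auto simp: K_def)
    \<comment> \<open>Chordality settles the case of attachments \<open>c\<close>, \<open>d\<close>
      in one component of \<open>R\<close>.\<close>
    have att: "E a b" if "c \<in> R" "E a c" "d \<in> R" "E b d" "reach_in R c d" for c d
      by (rule attachments_adjacent[OF ch v ab(1,2) _ _ ab(3,4) \<open>a \<noteq> b\<close> that(2,1,4,5)])
        (auto simp: R_def N_def)
    show "E a b"
    proof (rule ccontr)
      assume nab: "\<not> E a b"
      \<comment> \<open>Walks of length 0 and 1 in \<open>att\<close> show that \<open>a\<close> and
        \<open>b\<close> share neither \<open>a'\<close> nor \<open>b'\<close>, and that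
        \<open>a'\<close> and \<open>b'\<close> are not adjacent. Then
        \<open>a', a, v, b, b'\<close> is an induced path.\<close>
      have "\<not> E b a'" "\<not> E a b'"
        using att[of a' a'] att[of b' b'] a' b' nab by (auto simp: reach_in_def)
      moreover have "a' \<noteq> b'" using calculation(1) b' by auto
      moreover have "\<not> E a' b'"
        using att[of a' b'] a' b' nab by (auto simp: reach_in_def)
      moreover have "a' \<noteq> a" "a' \<noteq> b" "b' \<noteq> a" "b' \<noteq> b" "v \<noteq> a" "v \<noteq> b"
        using RD a' b' ab irrefl by auto
      moreover have "E a' a" "E b' b" "E a v" "E b v" "\<not> E b a" "\<not> E a' b" "\<not> E b' a"
        "\<not> E b' a'" "\<not> E a' v" "\<not> E b' v"
        using calculation a' b' ab nab RD sym by blast+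
      moreover have "{0..<5} = {0, 1, 2, 3, 4::nat}" by auto
      ultimately have "embeds (path_graph 5) ((!) [a', a, v, b, b']) U"
        using a' b' ab v nab \<open>a \<noteq> b\<close> RD irrefl
        by (simp add: embeds_def path_graph_def eval_nat_numeral) auto
      then show False using P5 unfolding P5_free_on_def by blast
    qed
  qed
  moreover have "K \<subset> N" using irrefl v by (auto simp: K_def N_def)
  moreover have "N \<subseteq> U" by (auto simp: N_def)
  ultimately obtain s where s: "s \<in> N" "s \<notin> K" "simplicial N s"
    using simplicial_outside_clique[of N K] finite_subset[OF _ fin] chordal_on_subset[OF ch] by blast
  \<comment> \<open>Being simplicial passes from \<open>N\<close> to \<open>U\<close> once
    \<open>s\<close> has no neighbour in \<open>R\<close>: by definition of \<open>N\<close> if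
    \<open>s = v\<close>, and by \<open>s \<notin> K\<close> otherwise.\<close>
  have "z \<in> N" if "z \<in> U" "E s z" for z
  proof (rule ccontr)
    assume "z \<notin> N"
    then have "z \<in> R" using that by (simp add: R_def)
    then show False using s(1,2) that RD by (auto simp: N_def K_def)
  qed
  then have "simplicial U s"
    using s(1,3) \<open>N \<subseteq> U\<close> unfolding simplicial_def clique_def by blast
  then show ?thesis using s(1) by (auto simp: N_def)
qed

section \<open>Inserting and deleting vertices on cycles\<close>

lemma cyc_rotate:
  assumes "cyc xs" "s \<in> set xs"
  obtains ys where "cyc (s # ys)" "set (s # ys) = set xs"
proof -
  obtain as bs where xs: "xs = as @ s # bs" using assms(2) by (meson split_list)
  have "cyc (s # bs @ as)"
    using assms(1) unfolding xs cyc_def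
    by (cases as) (auto simp: successively_append_iff successively_Cons hd_append last_append
        split: if_splits)
  then show ?thesis using that[of "bs @ as"] xs by auto
qed

lemma cyc_Cons:
  "cyc (s # ys) \<longleftrightarrow> distinct (s # ys) \<and> 2 \<le> length ys \<and> successively E ys \<and> E s (hd ys) \<and> E (last ys) s"
  by (cases ys) (auto simp: cyc_def successively_Cons)

text \<open>Both \<open>v\<close> and the predecessor of \<open>s\<close> on the cycle are
  neighbours of the simplicial vertex \<open>s\<close>, hence adjacent, so \<open>v\<close> fits
  between that predecessor and \<open>s\<close>.\<close>

lemma cyc_insert:
  assumes "cyc xs" "set xs \<subseteq> U" "simplicial U s" "s \<in> set xs" "v \<in> U" "v \<notin> set xs" "E v s"
  obtains zs where "cyc zs" "set zs = insert v (set xs)"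
proof -
  obtain ys where ys: "cyc (s # ys)" "set (s # ys) = set xs" using cyc_rotate assms by blast
  then have "ys \<noteq> []" by (auto simp: cyc_def)
  then have l: "last ys \<in> set xs" using last_in_set[of ys] ys(2)[symmetric] by simp
  have "E s (last ys)" using ys(1) sym unfolding cyc_Cons by blast
  moreover have "last ys \<noteq> v" using l assms(6) by blast
  ultimately have "E (last ys) v"
    using simplicialD[OF assms(3) _ assms(5) _ sym[OF assms(7)]] l assms(2) by blast
  then have "cyc (v # s # ys)"
    using ys assms(6,7) \<open>ys \<noteq> []\<close> by (auto simp: cyc_Cons successively_Cons)
  then show ?thesis using that[of "v # s # ys"] ys(2) by simp
qed

text \<open>The two cycle neighbours of \<open>s\<close> are adjacent, so the cycle can bypass
  \<open>s\<close>. Four vertices guarantee that at least three remain.\<close>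

lemma cyc_delete:
  assumes "cyc xs" "simplicial (set xs) s" "4 \<le> card (set xs)"
  obtains zs where "cyc zs" "set zs = set xs - {s}"
proof -
  have "s \<in> set xs" using assms(2) by (simp add: simplicial_def)
  then obtain ys where ys: "cyc (s # ys)" "set (s # ys) = set xs" using cyc_rotate assms by blast
  then have "card (set xs) = Suc (length ys)"
    by (metis cyc_def distinct_card length_Cons)
  then have len: "3 \<le> length ys" using assms(3) by simp
  then have ne: "hd ys \<noteq> last ys" "ys \<noteq> []"
    using ys(1) by (cases ys; auto simp: cyc_Cons)+
  then have "hd ys \<in> set xs" "last ys \<in> set xs"
    using hd_in_set[of ys] last_in_set[of ys] ys(2)[symmetric] by simp_all
  moreover have "E s (hd ys)" "E s (last ys)" using ys(1) sym unfolding cyc_Cons by blast+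
  ultimately have "E (last ys) (hd ys)"
    using simplicialD[OF assms(2), of "last ys" "hd ys"] ne(1) by simp
  then have "cyc ys" using ys(1) len by (simp add: cyc_def[of ys] cyc_Cons)
  moreover have "set ys = set xs - {s}" using ys by (auto simp: cyc_def)
  ultimately show ?thesis using that by blast
qed

text \<open>The list \<open>ds\<close> stands for an induced subgraph together with a Hamiltonian
  cycle of it. The induction shrinks \<open>ds\<close> and keeps \<open>xs\<close> fixed.\<close>

lemma extension_exists:
  assumes "chordal_on (set ds)" "P5_free_on (set ds)" "cyc ds" "cyc xs" "set xs \<subset> set ds"
  shows "\<exists>zs v. cyc zs \<and> v \<notin> set xs \<and> set zs = insert v (set xs)"
  using assms
proof (induction "card (set ds)" arbitrary: ds rule: less_induct)
  case less
  obtain v where v: "v \<in> set ds" "v \<notin> set xs" using less.prems(5) by blast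
  obtain s where s: "simplicial (set ds) s" "s = v \<or> E v s"
    using simplicial_dominating less.prems(1,2) v(1) by blast
  show ?case
  proof (cases "s \<in> set xs")
    case True
    then show ?thesis
      using cyc_insert[OF less.prems(4) psubset_imp_subset[OF less.prems(5)] s(1)] v s(2) by metis
  next
    case False
    have "3 \<le> card (set xs)" using less.prems(4) by (simp add: cyc_def distinct_card)
    then have "4 \<le> card (set ds)" using psubset_card_mono[OF _ less.prems(5)] by simp
    then obtain zs where zs: "cyc zs" "set zs = set ds - {s}"
      using cyc_delete[OF less.prems(3) s(1)] by blast
    have sD: "s \<in> set ds" using s(1) by (simp add: simplicial_def)
    show ?thesis
    proof (cases "set xs = set zs")
      case True
      \<comment> \<open>Now \<open>ds\<close> covers exactly \<open>xs\<close> and \<open>s\<close>,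
        so it is the extension.\<close>
      then show ?thesis using less.prems(3) False zs(2) sD by (metis insert_Diff)
    next
      case ne: False
      have sub: "set zs \<subseteq> set ds" using zs by blast
      have "card (set zs) < card (set ds)" unfolding zs(2) by (rule card_Diff1_less[OF finite_set sD])
      moreover have "set xs \<subset> set zs" using ne False less.prems(5) zs(2) by blast
      ultimately show ?thesis
        using less.hyps[OF _ chordal_on_subset[OF less.prems(1) sub]
            P5_free_on_subset[OF less.prems(2) sub] zs(1) less.prems(4)] by blast
    qed
  qed
qed

text \<open>A simplicial vertex forms a triangle with any two of its neighbours. If
  \<open>s = v\<close>, its two cycle neighbours are used; otherwise \<open>v\<close> and a cycle
  neighbour of \<open>s\<close> other than \<open>v\<close>.\<close>

lemma triangle_exists:
  assumes "chordal_on (set ds)" "P5_free_on (set ds)" "cyc ds" "v \<in> set ds"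
  shows "\<exists>xs. cyc xs \<and> length xs = 3 \<and> v \<in> set xs"
proof -
  obtain s where s: "simplicial (set ds) s" "s = v \<or> E v s"
    using simplicial_dominating assms by blast
  then have "s \<in> set ds" by (simp add: simplicial_def)
  then obtain ys where ys: "cyc (s # ys)" "set (s # ys) = set ds" using cyc_rotate assms by blast
  then have ne: "hd ys \<noteq> last ys" "ys \<noteq> []"
    by (cases ys; auto simp: cyc_Cons)+
  then have mem: "hd ys \<in> set ds" "last ys \<in> set ds"
    using hd_in_set[of ys] last_in_set[of ys] ys(2)[symmetric] by simp_all
  have adj: "E s (hd ys)" "E s (last ys)" using ys(1) sym unfolding cyc_Cons by blast+
  have tri: "cyc [s, a, b]" if "a \<in> set ds" "b \<in> set ds" "E s a" "E s b" "a \<noteq> b" for a b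
    using that simplicialD[OF s(1), of a b] irrefl sym[of s b] by (auto simp: cyc_def)
  show ?thesis
  proof (cases "s = v")
    case True
    then show ?thesis using tri[OF mem adj ne(1)] by (intro exI[of _ "[s, hd ys, last ys]"]) auto
  next
    case False
    then have "E s v" using s(2) sym by blast
    obtain t where "t \<in> set ds" "E s t" "t \<noteq> v" using mem adj ne(1) by metis
    then show ?thesis using tri[of v t] assms(4) \<open>E s v\<close> by (intro exI[of _ "[s, v, t]"]) auto
  qed
qed

end

section \<open>Transfer between adjacency relations and digraphs with arcs\<close>

lemma (in graph) simple_graph_dominates: "simple_graph (\<lambda>x y. x \<rightarrow>\<^bsub>G\<^esub> y)"
  by unfold_locales (use arcs_ends_symmetric[OF sym_arcs] adj_not_same in blast)+

text \<open>The isomorphism is the inverse of \<open>f\<close> on the subgraph induced by the image,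
  with each arc sent to its pair of ends; without parallel arcs this is injective. The condition on
  \<open>parcs F\<close> excludes stray arcs, about which \<open>embeds\<close> says
  nothing.\<close>

lemma (in graph) has_induced_if_embeds:
  assumes emb: "simple_graph.embeds (\<lambda>x y. x \<rightarrow>\<^bsub>G\<^esub> y) F f (verts G)"
    and F: "parcs F \<subseteq> pverts F \<times> pverts F"
  shows "has_induced (with_proj F) G"
proof -
  interpret S: simple_graph "\<lambda>x y. x \<rightarrow>\<^bsub>G\<^esub> y" by (rule simple_graph_dominates)
  have inj: "inj_on f (pverts F)" and sub: "f ` pverts F \<subseteq> verts G"
    and adj: "\<And>i j. i \<in> pverts F \<Longrightarrow> j \<in> pverts F \<Longrightarrow> (i, j) \<in> parcs F \<longleftrightarrow> f i \<rightarrow>\<^bsub>G\<^esub> f j"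
    using emb by (auto simp: S.embeds_def)
  define H where "H = G \<restriction> (f ` pverts F)"
  define g where "g = the_inv_into (pverts F) f"
  have g: "g (f i) = i" if "i \<in> pverts F" for i
    using that inj by (simp add: g_def the_inv_into_f_f)
  have ind: "induced_subgraph H G"
    unfolding H_def using sub by (rule induced_induce)
  define h where "h = \<lparr> iso_verts = g, iso_arcs = (\<lambda>e. (g (tail G e), g (head G e))),
    iso_head = snd, iso_tail = fst \<rparr>"
  have vH: "verts H = f ` pverts F" by (simp add: H_def)
  have aH: "arcs H = {e\<in>arcs G. tail G e \<in> f ` pverts F \<and> head G e \<in> f ` pverts F}"
    by (simp add: H_def)
  have th: "tail H = tail G" "head H = head G" by (simp_all add: H_def)
  have wf: "wf_digraph H" by unfold_locales (auto simp: vH aH th)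
  have injg: "inj_on g (verts H)" by (rule inj_onI) (auto simp: vH g)
  have "pre_digraph.digraph_isomorphism H h"
    unfolding pre_digraph.digraph_isomorphism_def
  proof (intro conjI ballI)
    show "inj_on (iso_arcs h) (arcs H)"
    proof (rule inj_onI)
      fix e e' assume e: "e \<in> arcs H" "e' \<in> arcs H" "iso_arcs h e = iso_arcs h e'"
      then have "tail G e = tail G e'" "head G e = head G e'"
        by (auto simp: h_def aH g)
      then show "e = e'" using e no_multi_arcs by (auto simp: aH arc_to_ends_def)
    qed
  qed (use wf injg in \<open>auto simp: h_def th\<close>)
  moreover have "app_iso h H = with_proj F"
  proof -
    have "g ` verts H = pverts F" using g by (force simp: vH)
    moreover have "(\<lambda>e. (g (tail G e), g (head G e))) ` arcs H = parcs F"
    proof (intro equalityI subsetI)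
      fix ij assume "ij \<in> (\<lambda>e. (g (tail G e), g (head G e))) ` arcs H"
      then obtain e i j where "e \<in> arcs G" "tail G e = f i" "head G e = f j"
        "i \<in> pverts F" "j \<in> pverts F" "ij = (i, j)" by (auto simp: aH g)
      then show "ij \<in> parcs F" using adj by (force simp: arcs_ends_conv)
    next
      fix ij assume "ij \<in> parcs F"
      then obtain i j where ij: "ij = (i, j)" "i \<in> pverts F" "j \<in> pverts F" "(i, j) \<in> parcs F"
        using F by blast
      then have "f i \<rightarrow>\<^bsub>G\<^esub> f j" using adj by blast
      then obtain e where "e \<in> arcs G" "tail G e = f i" "head G e = f j" by blast
      then show "ij \<in> (\<lambda>e. (g (tail G e), g (head G e))) ` arcs H"
        using ij g by (force simp: aH)
    qed
    ultimately show ?thesis by (simp add: app_iso_def h_def with_proj_def)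
  qed
  ultimately show ?thesis
    unfolding has_induced_def digraph_iso_def using ind by metis
qed

context graph
begin

interpretation S: simple_graph "\<lambda>x y. x \<rightarrow>\<^bsub>G\<^esub> y" by (rule simple_graph_dominates)

text \<open>The tails of the arcs give every vertex of the walk except the last, hence the appended
  \<open>v\<close>.\<close>

lemma cas_successively:
  "cas u p v \<and> set p \<subseteq> arcs G \<Longrightarrow>
    successively (\<lambda>x y. x \<rightarrow>\<^bsub>G\<^esub> y) (map (tail G) p @ [v]) \<and> (p \<noteq> [] \<longrightarrow> tail G (hd p) = u)"
  by (induction u p v rule: cas.induct) (auto simp: successively_Cons arcs_ends_conv hd_append hd_map)

lemma cyc_if_graph_cycle:
  assumes "graph_cycle G C"
  shows "S.cyc (map (tail G) C)"
proof -
  obtain u where u: "awalk u C u" "distinct (tl (awalk_verts u C))" "C \<noteq> []" "3 \<le> length C"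
    using assms by (auto simp: graph_cycle_def cycle_def)
  have cas: "cas u C u" "set C \<subseteq> arcs G" using u(1) by (auto simp: awalk_def)
  then have s: "successively (\<lambda>x y. x \<rightarrow>\<^bsub>G\<^esub> y) (map (tail G) C @ [u])" "tail G (hd C) = u"
    using cas_successively[of u C u] u(3) by auto
  obtain e C' where C: "C = e # C'" using u(3) by (cases C) auto
  have "awalk_verts u C = map (tail G) C @ [u]"
    using awlast_if_cas[OF cas(1)] u(3) by (auto simp: awalk_verts_conv)
  \<comment> \<open>The walk lists \<open>u\<close> at both ends. Distinctness holds with
    \<open>u\<close> in the last place and is moved to the first, where \<open>u\<close> is the tail
    of \<open>e\<close>.\<close>
  then have "distinct (map (tail G) C' @ [u])" using u(2) C by simp
  then have "distinct (map (tail G) C)" using s(2) C by auto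
  then show ?thesis
    using s u(3,4) by (auto simp: S.cyc_def successively_append_iff hd_map)
qed

text \<open>An arc is chosen for each consecutive pair. Writing the start as
  \<open>hd (xs @ [v])\<close> covers the empty walk at \<open>v\<close>.\<close>

lemma awalk_if_successively:
  assumes "successively (\<lambda>x y. x \<rightarrow>\<^bsub>G\<^esub> y) (xs @ [v])"
  shows "\<exists>p. map (tail G) p = xs \<and> set p \<subseteq> arcs G \<and> cas (hd (xs @ [v])) p v"
  using assms
proof (induction xs)
  case (Cons x xs)
  then obtain p where p: "map (tail G) p = xs" "set p \<subseteq> arcs G" "cas (hd (xs @ [v])) p v"
    by (auto simp: successively_Cons)
  have "x \<rightarrow>\<^bsub>G\<^esub> hd (xs @ [v])" using Cons.prems by (simp add: successively_Cons)
  then obtain e where "e \<in> arcs G" "tail G e = x" "head G e = hd (xs @ [v])" by blast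
  then show ?case using p by (intro exI[of _ "e # p"]) auto
qed simp

lemma graph_cycle_if_cyc:
  assumes "S.cyc xs"
  obtains C where "graph_cycle G C" "map (tail G) C = xs"
proof -
  have xs: "xs \<noteq> []" "3 \<le> length xs" "distinct xs" using assms by (auto simp: S.cyc_def)
  then have "successively (\<lambda>x y. x \<rightarrow>\<^bsub>G\<^esub> y) (xs @ [hd xs])"
    using assms by (auto simp: S.cyc_def successively_append_iff)
  then obtain p where p: "map (tail G) p = xs" "set p \<subseteq> arcs G" "cas (hd xs) p (hd xs)"
    using awalk_if_successively[of xs "hd xs"] xs(1) by auto
  have ne: "p \<noteq> []" using p(1) xs(1) by auto
  then have "hd xs = tail G (hd p)" "hd p \<in> arcs G" using p by (auto simp: hd_map)
  then have "awalk (hd xs) p (hd xs)" using p by (simp add: awalk_def)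
  moreover have "awalk_verts (hd xs) p = xs @ [hd xs]"
    using awlast_if_cas[OF p(3)] p(1) ne by (auto simp: awalk_verts_conv)
  moreover have "distinct (tl xs @ [hd xs])" using xs(1,3) by (cases xs) auto
  ultimately have "cycle p" using ne xs(1) unfolding cycle_def by auto
  then show ?thesis using that[of p] p(1) xs(2) by (auto simp: graph_cycle_def)
qed

lemma chordal_on_verts: "chordal G \<Longrightarrow> S.chordal_on (verts G)"
  using has_induced_if_embeds[of "cycle_graph _"]
  by (fastforce simp: chordal_def S.chordal_on_def cycle_graph_def)

lemma P5_free_on_verts: "P5_free G \<Longrightarrow> S.P5_free_on (verts G)"
  using has_induced_if_embeds[of "path_graph 5"]
  by (fastforce simp: P5_free_def S.P5_free_on_def path_graph_def)

lemma fully_cycle_extendable_if_chordal_P5_free: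
  assumes "P5_free G" "hamiltonian G" "chordal G"
  shows "fully_cycle_extendable G"
proof -
  obtain D where D: "graph_cycle G D" "cycle_verts G D = verts G"
    using assms(2) by (auto simp: hamiltonian_def hamiltonian_cycle_def)
  define ds where "ds = map (tail G) D"
  have ds: "S.cyc ds" "set ds = verts G"
    using cyc_if_graph_cycle[OF D(1)] D(2) by (auto simp: ds_def cycle_verts_def)
  have ch: "S.chordal_on (set ds)" "S.P5_free_on (set ds)"
    using chordal_on_verts P5_free_on_verts assms ds(2) by auto
  have "extendable G C" if C: "graph_cycle G C" "\<not> hamiltonian_cycle G C" for C
  proof -
    let ?xs = "map (tail G) C"
    have xs: "S.cyc ?xs" using cyc_if_graph_cycle[OF C(1)] .
    have "set C \<subseteq> arcs G" using C(1) by (auto simp: graph_cycle_def cycle_def awalk_def)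
    then have "set ?xs \<subseteq> verts G" by auto
    moreover have "set ?xs \<noteq> verts G"
      using C by (simp add: hamiltonian_cycle_def cycle_verts_def)
    ultimately have "set ?xs \<subset> set ds" using ds(2) by blast
    from S.extension_exists[OF ch ds(1) xs this]
    obtain zs v where zs: "S.cyc zs" "v \<notin> set ?xs" "set zs = insert v (set ?xs)" by blast
    obtain C' where C': "graph_cycle G C'" "map (tail G) C' = zs"
      using graph_cycle_if_cyc[OF zs(1)] .
    \<comment> \<open>Both lists are distinct, so their lengths count vertices.\<close>
    have "length zs = Suc (length ?xs)"
      using zs xs by (metis S.cyc_def distinct_card card_insert_disjoint finite_set)
    then have "length C' = length C + 1" using C'(2) by auto
    moreover have "cycle_verts G C' - cycle_verts G C = {v}"
      using zs C'(2) unfolding cycle_verts_def set_map[symmetric] by auto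
    ultimately show ?thesis
      using C'(1) by (auto simp: extendable_def cycle_extension_def)
  qed
  moreover have "\<exists>T. graph_cycle G T \<and> length T = 3 \<and> v \<in> cycle_verts G T" if "v \<in> verts G" for v
  proof -
    obtain xs where xs: "S.cyc xs" "length xs = 3" "v \<in> set xs"
      using S.triangle_exists[OF ch ds(1)] \<open>v \<in> verts G\<close> ds(2) by blast
    obtain T where T: "graph_cycle G T" "map (tail G) T = xs"
      using graph_cycle_if_cyc[OF xs(1)] .
    then show ?thesis using xs by (intro exI[of _ T]) (auto simp: cycle_verts_def)
  qed
  ultimately show ?thesis by (auto simp: fully_cycle_extendable_def cycle_extendable_def)
qed

end

theorem theorem3p5:
  fixes G :: "('a, 'b) pre_digraph"
  assumes "graph G"
    and "P5_free G"
    and "hamiltonian G"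
    and "chordal G"
  shows "fully_cycle_extendable G"
  using graph.fully_cycle_extendable_if_chordal_P5_free[OF assms] .

end
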